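(* For every graph $G$ of order $n$, there exists a clique covering $\mathcal{C}$ of $E(G)$ such that for each non-isolated vertex $v\in V(G)$, $$val_{\mathcal{C}}(v)+\frac{n}{\alpha_G(v)}\leq n+1.$$
   Context: All graphs are finite, simple and undirected. A clique of $G$ is a set of pairwise adjacent vertices. A clique covering of $E(G)$ is a family $\mathcal{C}$ of cliques of $G$ such that every edge of $G$ lies in at least one member of $\mathcal{C}$. For a vertex $v$, its valency $val_{\mathcal{C}}(v)$ is the number of cliques in $\mathcal{C}$ containing $v$. For a vertex $v$, $N(v)$ is its (open) neighborhood and $\alpha_G(v)=\alpha(G[N(v)])$ is the maximum number of pairwise non-adjacent vertices in $N(v)$ (so $\alpha_G(v)\ge 1$ when $v$ is non-isolated). *)

theory Defs
  imports Complex_Main "HOL-Library.Ramsey"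
begin

text \<open>
  A graph is given by a vertex set \<open>V\<close> and a set \<open>E\<close> of two-element subsets of \<open>V\<close>, which
  is the representation used by \<^const>\<open>clique\<close> and \<^const>\<open>indep\<close>.
\<close>

definition simple_graph :: "'a set \<Rightarrow> 'a set set \<Rightarrow> bool" where
  "simple_graph V E \<longleftrightarrow> finite V \<and> E \<subseteq> nsets V 2"

definition neighborhood :: "'a set set \<Rightarrow> 'a \<Rightarrow> 'a set" where
  "neighborhood E v = {w. {v, w} \<in> E}"

definition isolated :: "'a set set \<Rightarrow> 'a \<Rightarrow> bool" where
  "isolated E v \<longleftrightarrow> neighborhood E v = {}"

definition induced_edges :: "'a set set \<Rightarrow> 'a set \<Rightarrow> 'a set set" where
  "induced_edges E S = {e \<in> E. e \<subseteq> S}"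

definition independence_number :: "'a set \<Rightarrow> 'a set set \<Rightarrow> nat" where
  "independence_number V E = Max (card ` {S. S \<subseteq> V \<and> indep S E})"

definition local_independence_number :: "'a set set \<Rightarrow> 'a \<Rightarrow> nat" where
  "local_independence_number E v =
     independence_number (neighborhood E v) (induced_edges E (neighborhood E v))"

definition clique_covering :: "'a set \<Rightarrow> 'a set set \<Rightarrow> 'a set set \<Rightarrow> bool" where
  "clique_covering V E \<C> \<longleftrightarrow>
     (\<forall>K\<in>\<C>. K \<subseteq> V \<and> clique K E) \<and> (\<forall>e\<in>E. \<exists>K\<in>\<C>. e \<subseteq> K)"

definition valency :: "'a set set \<Rightarrow> 'a \<Rightarrow> nat" where
  "valency \<C> v = card {K \<in> \<C>. v \<in> K}"

text \<open>
  Neither the maximum nor the cardinality above is degenerate on a finite graph; in particular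
  no division by zero occurs for a non-isolated vertex.
\<close>

lemma finite_neighborhood:
  assumes "simple_graph V E"
  shows "finite (neighborhood E v)"
proof (rule finite_subset)
  show "neighborhood E v \<subseteq> V"
    using assms by (auto simp: simple_graph_def neighborhood_def nsets_def)
  show "finite V"
    using assms by (simp add: simple_graph_def)
qed

lemma local_independence_number_ge_1:
  assumes "simple_graph V E" and "\<not> isolated E v"
  shows "local_independence_number E v \<ge> 1"
proof -
  let ?N = "neighborhood E v"
  obtain w where "w \<in> ?N"
    using assms(2) by (auto simp: isolated_def)
  then have "card {w} \<in> card ` {S. S \<subseteq> ?N \<and> indep S (induced_edges E ?N)}"
    by (intro imageI) (simp add: indep_def)
  moreover have "finite (card ` {S. S \<subseteq> ?N \<and> indep S (induced_edges E ?N)})"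
    using finite_neighborhood[OF assms(1), of v] by simp
  ultimately show ?thesis
    unfolding local_independence_number_def independence_number_def
    by (metis Max_ge card_1_singleton_iff One_nat_def)
qed

lemma finite_clique_covering:
  assumes "simple_graph V E" and "clique_covering V E \<C>"
  shows "finite \<C>"
  using assms finite_subset[of \<C> "Pow V"]
  by (auto simp: simple_graph_def clique_covering_def)

end

theory Submission
  imports Defs
begin

text \<open>
  Induction on \<open>n\<close>, deleting both ends of an edge \<open>xy\<close>. Each of \<open>N(x) \<inter> N(y)\<close>,
  \<open>N(x) - N[y]\<close> and \<open>N(y) - N[x]\<close> is partitioned into cliques, and \<open>{x, y}\<close>, \<open>{x}\<close> and
  \<open>{y}\<close>, respectively, are joined to every part. A remaining vertex \<open>v\<close> lies in at most one new
  clique, while its bound \<open>n + 1 - n / \<alpha>(v)\<close> grows by \<open>2 - 2 / \<alpha>(v) \<ge> 1\<close> as soon as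
  \<open>\<alpha>(v) \<ge> 2\<close>. Taking a maximal matching for the partition of a set \<open>X\<close> gives, for \<open>\<alpha> \<ge> 2\<close>, at
  most \<open>|X| + 1 - |X| / \<alpha>\<close> parts, a local form of the Nordhaus-Gaddum bound; two such sets make up
  the rest of \<open>N(x)\<close>, and \<open>d(x) \<le> n - 1\<close> then yields the bound at \<open>x\<close>. The vertices with
  \<open>\<alpha>(v) = 1\<close> are repaired last: replacing all cliques through \<open>v\<close> by \<open>N[v]\<close> increases no
  valency.
\<close>

section \<open>Graphs\<close>

text \<open>In a finite graph these are the vertices with \<alpha>(v) = 1, where the required bound
  on the valency is 1.\<close>

definition simplicial :: "'a set set \<Rightarrow> 'a \<Rightarrow> bool" where
  "simplicial E v \<longleftrightarrow> \<not> isolated E v \<and> clique (neighborhood E v) E"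

lemma mem_neighborhood: "w \<in> neighborhood E v \<longleftrightarrow> {v, w} \<in> E"
  by (simp add: neighborhood_def)

lemma simple_graph_edgeD:
  assumes "simple_graph V E" "{v, w} \<in> E"
  shows "v \<in> V" "w \<in> V" "v \<noteq> w"
  using assms by (auto simp: simple_graph_def nsets_def card_insert_if split: if_splits)

lemma simple_graph_edgeE:
  assumes "simple_graph V E" "e \<in> E"
  obtains v w where "e = {v, w}" "v \<in> V" "w \<in> V" "v \<noteq> w"
proof -
  have "e \<subseteq> V" "card e = 2"
    using assms by (auto simp: simple_graph_def nsets_def)
  then show thesis
    using that by (auto simp: card_2_iff)
qed

lemma neighborhood_subset:
  assumes "simple_graph V E"
  shows "neighborhood E v \<subseteq> V - {v}"
proof
  fix w assume "w \<in> neighborhood E v"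
  then show "w \<in> V - {v}"
    using simple_graph_edgeD[OF assms, of v w] by (simp add: mem_neighborhood)
qed

lemma card_neighborhood_less:
  assumes "simple_graph V E" "v \<in> V"
  shows "card (neighborhood E v) < card V"
proof -
  have "finite V"
    using assms by (simp add: simple_graph_def)
  then show ?thesis
    using neighborhood_subset[OF assms(1), of v] assms(2) by (intro psubset_card_mono) auto
qed

lemma simple_graph_induced:
  assumes "simple_graph V E" "W \<subseteq> V"
  shows "simple_graph W (induced_edges E W)"
  using assms finite_subset[of W V]
  by (auto simp: simple_graph_def induced_edges_def nsets_def)

lemma cliqueD: "clique K E \<Longrightarrow> v \<in> K \<Longrightarrow> w \<in> K \<Longrightarrow> v \<noteq> w \<Longrightarrow> {v, w} \<in> E"
  by (simp add: clique_def)

lemma clique_subset_closed_neighborhood: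
  assumes "clique K E" "v \<in> K"
  shows "K \<subseteq> insert v (neighborhood E v)"
  using assms unfolding clique_def mem_neighborhood subset_iff insert_iff by metis

lemma clique_insert:
  assumes "clique K E" "K \<subseteq> neighborhood E v"
  shows "clique (insert v K) E"
  using assms by (auto simp: clique_def mem_neighborhood insert_commute)

section \<open>Merging the cliques at simplicial vertices\<close>

lemma simplicial_clique:
  "simplicial E v \<Longrightarrow> clique (insert v (neighborhood E v)) E"
  by (rule clique_insert) (auto simp: simplicial_def)

text \<open>Each closed neighborhood is a clique containing the other vertex, so it lies inside the
  other one. This makes the replacement of a clique below independent of the simplicial vertex
  chosen in it.\<close>

lemma simplicial_closed_neighborhood_eq:
  assumes "simplicial E v" "simplicial E w" "{v, w} \<in> E"
  shows "insert v (neighborhood E v) = insert w (neighborhood E w)"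
proof
  show "insert v (neighborhood E v) \<subseteq> insert w (neighborhood E w)"
    using clique_subset_closed_neighborhood[OF simplicial_clique[OF assms(1)], of w] assms(3)
    by (auto simp: mem_neighborhood)
  show "insert w (neighborhood E w) \<subseteq> insert v (neighborhood E v)"
    using clique_subset_closed_neighborhood[OF simplicial_clique[OF assms(2)], of v] assms(3)
    by (auto simp: mem_neighborhood insert_commute)
qed

text \<open>Cliques without edges are dropped, and a clique with a simplicial vertex v grows to
  N[v]. No valency rises, because every resulting clique through a vertex u is also the image of an
  old clique through u.\<close>

lemma clique_covering_merge_simplicial:
  assumes G: "simple_graph V E" and C: "clique_covering V E C"
  shows "\<exists>D. clique_covering V E D \<and>
    (\<forall>v. valency D v \<le> valency C v) \<and>
    (\<forall>v. isolated E v \<longrightarrow> valency D v = 0) \<and>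
    (\<forall>v. simplicial E v \<longrightarrow> valency D v \<le> 1)"
proof -
  define g where "g K = (if \<exists>v\<in>K. simplicial E v
    then (let v = SOME v. v \<in> K \<and> simplicial E v in insert v (neighborhood E v)) else K)" for K
  \<comment> \<open>Discarding empty cliques and singletons is what gives isolated vertices valency
    0.\<close>
  define C' where "C' = {K \<in> C. \<exists>e\<in>E. e \<subseteq> K}"
  define D where "D = g ` C'"
  have fin: "finite C"
    using finite_clique_covering[OF G C] .
  have Kcl: "clique K E" "K \<subseteq> V" if "K \<in> C" for K
    using C that by (auto simp: clique_covering_def)
  have cover: "\<exists>K\<in>C'. e \<subseteq> K" if "e \<in> E" for e
    using C that unfolding clique_covering_def C'_def by blast
  \<comment> \<open>The \<open>SOME\<close> in \<open>g\<close> is harmless: two simplicial vertices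
    of one clique are adjacent and hence have the same closed neighborhood.\<close>
  have g_simp: "g K = insert v (neighborhood E v)"
    if "K \<in> C" "v \<in> K" "simplicial E v" for K v
  proof -
    define w where "w = (SOME w. w \<in> K \<and> simplicial E w)"
    have w: "w \<in> K \<and> simplicial E w"
      unfolding w_def by (rule someI[of _ v]) (use that in auto)
    have "g K = insert w (neighborhood E w)"
      using that by (auto simp: g_def w_def Let_def)
    also have "\<dots> = insert v (neighborhood E v)"
    proof (cases "v = w")
      case False
      then show ?thesis
        using simplicial_closed_neighborhood_eq[of E w v] w that cliqueD[OF Kcl(1), of K w v]
        by auto
    qed simp
    finally show ?thesis .
  qed
  have g_other: "g K = K" if "\<not> (\<exists>v\<in>K. simplicial E v)" for K
    using that by (simp add: g_def)
  have g_sup: "K \<subseteq> g K" and g_cl: "clique (g K) E" and g_V: "g K \<subseteq> V" if "K \<in> C" for K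
  proof -
    have "K \<subseteq> g K \<and> clique (g K) E \<and> g K \<subseteq> V"
    proof (cases "\<exists>v\<in>K. simplicial E v")
      case True
      then obtain v where v: "v \<in> K" "simplicial E v" by blast
      then show ?thesis
        using g_simp[OF that v] clique_subset_closed_neighborhood[OF Kcl(1)[OF that] v(1)]
          simplicial_clique[OF v(2)] neighborhood_subset[OF G, of v] Kcl(2)[OF that] by auto
    next
      case False
      then show ?thesis
        using g_other Kcl[OF that] by auto
    qed
    then show "K \<subseteq> g K" "clique (g K) E" "g K \<subseteq> V" by auto
  qed
  \<comment> \<open>If L = N[v] came from a clique that misses u, then vu is an edge, and any kept
    clique \<open>K'\<close> covering it contains v and is also sent to L.\<close>
  have preimage: "\<exists>K'\<in>C'. u \<in> K' \<and> g K' = L" if L: "L \<in> D" "u \<in> L" for L u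
  proof -
    obtain K where K: "K \<in> C'" "L = g K"
      using L(1) by (auto simp: D_def)
    show ?thesis
    proof (cases "u \<in> K")
      case False
      then obtain v where v: "v \<in> K" "simplicial E v"
        using K L(2) g_other by metis
      then have L_eq: "L = insert v (neighborhood E v)"
        using K g_simp by (auto simp: C'_def)
      then have "{v, u} \<in> E"
        using L(2) False v by (auto simp: mem_neighborhood)
      from cover[OF this] obtain K' where "K' \<in> C'" "{v, u} \<subseteq> K'" by blast
      then show ?thesis
        using g_simp[of K' v] v L_eq by (auto simp: C'_def)
    qed (use K in auto)
  qed
  have val: "valency D v \<le> valency C v" for v
  proof -
    have "{L \<in> D. v \<in> L} \<subseteq> g ` {K \<in> C. v \<in> K}"
      using preimage[of _ v] by (fastforce simp: C'_def)
    then show ?thesis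
      unfolding valency_def using fin by (intro surj_card_le) auto
  qed
  have iso: "valency D v = 0" if "isolated E v" for v
  proof -
    have "v \<notin> L" if L: "L \<in> D" for L
    proof
      assume "v \<in> L"
      then obtain K where K: "K \<in> C'" "v \<in> K"
        using preimage L by blast
      then obtain e where e: "e \<in> E" "e \<subseteq> K" by (auto simp: C'_def)
      then obtain a b where ab: "e = {a, b}" "a \<noteq> b"
        using simple_graph_edgeE[OF G] by metis
      obtain w where w: "w \<in> K" "w \<noteq> v"
        using ab e by (cases "a = v") auto
      have "{v, w} \<in> E"
        using cliqueD[OF Kcl(1), of K v w] K w by (auto simp: C'_def)
      then show False
        using \<open>isolated E v\<close> by (auto simp: isolated_def mem_neighborhood)
    qed
    then have "{L \<in> D. v \<in> L} = {}"
      by blast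
    then show ?thesis
      by (simp only: valency_def card.empty)
  qed
  have simplicial: "valency D v \<le> 1" if "simplicial E v" for v
  proof -
    have "{L \<in> D. v \<in> L} \<subseteq> {insert v (neighborhood E v)}"
      using preimage[of _ v] g_simp[OF _ _ that] by (fastforce simp: C'_def)
    then have "card {L \<in> D. v \<in> L} \<le> card {insert v (neighborhood E v)}"
      by (intro card_mono) auto
    then show ?thesis
      by (simp add: valency_def)
  qed
  have "clique_covering V E D"
    unfolding clique_covering_def
  proof (intro conjI ballI)
    fix L assume "L \<in> D"
    then show "L \<subseteq> V" "clique L E"
      using g_cl g_V by (auto simp: D_def C'_def)
  next
    fix e assume "e \<in> E"
    from cover[OF this] obtain K where "K \<in> C'" "e \<subseteq> K" by blast
    then show "\<exists>L\<in>D. e \<subseteq> L"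
      using g_sup[of K] by (auto simp: D_def C'_def)
  qed
  then show ?thesis
    using val iso simplicial by blast
qed

section \<open>Partitioning vertex sets into cliques\<close>

text \<open>
  \<open>P \<noteq> {}\<close> forces \<open>P = {{}}\<close> for \<open>X = {}\<close>: the deleted edge \<open>xy\<close> must be covered even if its ends
  have no common neighbour.
\<close>

lemma clique_partition:
  assumes "finite X"
  shows "\<exists>P. finite P \<and> P \<noteq> {} \<and> \<Union>P = X \<and> (\<forall>R\<in>P. clique R E) \<and>
    (\<forall>R\<in>P. \<forall>R'\<in>P. \<forall>u. u \<in> R \<longrightarrow> u \<in> R' \<longrightarrow> R = R') \<and>
    (\<forall>a\<ge>2. (\<forall>S\<subseteq>X. indep S E \<longrightarrow> card S \<le> a) \<longrightarrow>
      a * card P + card X \<le> a * card X + a)"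
  using assms
proof (induction "card X" arbitrary: X rule: less_induct)
  case less
  show ?case
  proof (cases "indep X E")
    \<comment> \<open>With no edges left the parts are singletons, and \<open>card X \<le> a\<close>
      because \<open>X\<close> itself is independent. For empty \<open>X\<close> the single part
      \<open>{}\<close> attains equality.\<close>
    case True
    show ?thesis
    proof (cases "X = {}")
      case True
      then show ?thesis
        by (intro exI[of _ "{{}}"]) (auto simp: clique_def)
    next
      case False
      have "card ((\<lambda>u. {u}) ` X) = card X"
        by (rule card_image) simp
      then show ?thesis
        using False True less.prems
        by (intro exI[of _ "(\<lambda>u. {u}) ` X"]) (auto simp: clique_def)
    qed
  next
    case False
    then obtain u w where uw: "u \<in> X" "w \<in> X" "u \<noteq> w" "{u, w} \<in> E"
      by (auto simp: indep_def)
    define X' where "X' = X - {u, w}"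
    have cardX: "card X = card X' + 2"
    proof -
      have "card X' = card X - card {u, w}"
        unfolding X'_def using uw less.prems by (intro card_Diff_subset) auto
      moreover have "card {u, w} \<le> card X"
        using uw less.prems by (intro card_mono) auto
      ultimately show ?thesis
        using uw by simp
    qed
    have "finite X'"
      using less.prems by (simp add: X'_def)
    with less.hyps[of X'] cardX obtain P where P: "finite P" "P \<noteq> {}" "\<Union>P = X'"
      "\<forall>R\<in>P. clique R E" "\<forall>R\<in>P. \<forall>R'\<in>P. \<forall>u. u \<in> R \<longrightarrow> u \<in> R' \<longrightarrow> R = R'"
      "\<forall>a\<ge>2. (\<forall>S\<subseteq>X'. indep S E \<longrightarrow> card S \<le> a) \<longrightarrow> a * card P + card X' \<le> a * card X' + a"
      by auto
    have notP: "u \<notin> R" "w \<notin> R" if "R \<in> P" for R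
      using P(3) that by (auto simp: X'_def)
    \<comment> \<open>The new pair raises the left side by a + 2 and the right side by 2a, so a
      \<ge> 2 is needed.\<close>
    have bound: "a * card (insert {u, w} P) + card X \<le> a * card X + a"
      if "a \<ge> 2" "\<forall>S\<subseteq>X. indep S E \<longrightarrow> card S \<le> a" for a
    proof -
      have "X' \<subseteq> X"
        by (auto simp: X'_def)
      then have "\<forall>S\<subseteq>X'. indep S E \<longrightarrow> card S \<le> a"
        using that(2) by blast
      then have "a * card P + card X' \<le> a * card X' + a"
        using P(6) that(1) by blast
      moreover have "card (insert {u, w} P) = card P + 1"
        using P(1) notP by (subst card_insert_disjoint) auto
      ultimately show ?thesis
        using that(1) by (simp add: cardX algebra_simps)
    qed
    show ?thesis
    proof (intro exI[of _ "insert {u, w} P"] conjI)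
      show "\<Union>(insert {u, w} P) = X"
        using P(3) uw by (auto simp: X'_def)
      show "\<forall>R\<in>insert {u, w} P. clique R E"
        using P(4) uw by (auto simp: clique_def insert_commute)
      show "\<forall>R\<in>insert {u, w} P. \<forall>R'\<in>insert {u, w} P. \<forall>v. v \<in> R \<longrightarrow> v \<in> R' \<longrightarrow> R = R'"
        using P(5) notP by blast
    qed (use P(1) bound in auto)
  qed
qed

section \<open>The covering\<close>

text \<open>The arithmetic at x and y: the two partition bounds add up to am + b + c \<le> a(b + c)
  + 2a. Passing from b + c to n = b + c + 2 + r costs 2 + r on the left and gains 2a + ar on the
  right, of which a suffices to absorb the second additive a.\<close>

lemma valency_bound_edge_end:
  fixes a :: nat
  assumes "a \<ge> 2"
    and "a * p + c \<le> a * c + a" and "a * q + b \<le> a * b + a"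
    and "b + c + 2 \<le> n" and "m \<le> p + q"
  shows "a * m + n \<le> a * n + a"
proof -
  obtain r where r: "n = b + c + 2 + r"
    using assms(4) le_Suc_ex by blast
  have "a * m \<le> a * p + a * q"
    using assms(5) by (metis add_mult_distrib2 mult_le_mono2)
  moreover have "r \<le> a * r"
    using assms(1) by simp
  moreover have "a * n = a * b + a * c + 2 * a + a * r"
    by (simp add: r algebra_simps)
  ultimately show ?thesis
    using assms(1-3) r by linarith
qed

text \<open>The bound is multiplied by a to stay within natural numbers. Quantifying over all upper
  bounds a, rather than fixing \<alpha>(v), lets the induction survive a drop of \<alpha>(v) in the
  smaller graph. Valency 0 at isolated vertices serves those vertices that lose all their neighbors
  when x and y are deleted.\<close>

lemma exists_clique_covering:
  assumes "simple_graph V E"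
  shows "\<exists>C. clique_covering V E C \<and> (\<forall>v. isolated E v \<longrightarrow> valency C v = 0) \<and>
    (\<forall>v\<in>V. \<not> isolated E v \<longrightarrow> (\<forall>a. (\<forall>S\<subseteq>neighborhood E v. indep S E \<longrightarrow> card S \<le> a) \<longrightarrow>
      a * valency C v + card V \<le> a * card V + a))"
  using assms
proof (induction "card V" arbitrary: V E rule: less_induct)
  case less
  note G = less.prems
  have finV: "finite V"
    using G by (simp add: simple_graph_def)
  show ?case
  proof (cases "E = {}")
    case True
    then show ?thesis
      by (intro exI[of _ "{}"])
        (auto simp: clique_covering_def valency_def isolated_def neighborhood_def)
  next
    case False
    then obtain x y where xy: "{x, y} \<in> E" "x \<in> V" "y \<in> V" "x \<noteq> y"
      using simple_graph_edgeE[OF G] by (metis all_not_in_conv)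
    let ?N = "neighborhood E"
    define V' where "V' = V - {x, y}"
    define E' where "E' = induced_edges E V'"
    have cardV: "card V = card V' + 2"
    proof -
      have "card V' = card V - card {x, y}"
        unfolding V'_def using xy by (intro card_Diff_subset) auto
      moreover have "card {x, y} \<le> card V"
        using xy finV by (intro card_mono) auto
      ultimately show ?thesis
        using xy by simp
    qed
    have G': "simple_graph V' E'"
      unfolding E'_def by (rule simple_graph_induced[OF G]) (auto simp: V'_def)
    from less.hyps[OF _ G'] cardV obtain C' where C': "clique_covering V' E' C'"
      and iso': "\<forall>v. isolated E' v \<longrightarrow> valency C' v = 0"
      and bound': "\<forall>v\<in>V'. \<not> isolated E' v \<longrightarrow>
        (\<forall>a. (\<forall>S\<subseteq>neighborhood E' v. indep S E' \<longrightarrow> card S \<le> a) \<longrightarrow>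
        a * valency C' v + card V' \<le> a * card V' + a)"
      by auto
    have finN: "finite (?N v)" for v
      using finite_neighborhood[OF G] .
    define X Y Z where "X = ?N x - ?N y - {y}" and "Y = ?N y - ?N x - {x}" and "Z = ?N x \<inter> ?N y"
    have "finite X" "finite Y" "finite Z"
      using finN by (auto simp: X_def Y_def Z_def)
    obtain P where P: "finite P" "\<Union>P = X" "\<forall>K\<in>P. clique K E"
      "\<forall>K\<in>P. \<forall>L\<in>P. \<forall>u. u \<in> K \<longrightarrow> u \<in> L \<longrightarrow> K = L"
      "\<forall>a\<ge>2. (\<forall>S\<subseteq>X. indep S E \<longrightarrow> card S \<le> a) \<longrightarrow>
        a * card P + card X \<le> a * card X + a"
      using clique_partition[OF \<open>finite X\<close>, of E] by (elim exE conjE) (rule that)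
    obtain Q where Q: "finite Q" "\<Union>Q = Y" "\<forall>K\<in>Q. clique K E"
      "\<forall>K\<in>Q. \<forall>L\<in>Q. \<forall>u. u \<in> K \<longrightarrow> u \<in> L \<longrightarrow> K = L"
      "\<forall>a\<ge>2. (\<forall>S\<subseteq>Y. indep S E \<longrightarrow> card S \<le> a) \<longrightarrow>
        a * card Q + card Y \<le> a * card Y + a"
      using clique_partition[OF \<open>finite Y\<close>, of E] by (elim exE conjE) (rule that)
    \<comment> \<open>This one partition of the common neighbors is used at both x and y, whose
      values of a may differ; hence a is quantified after the partition.\<close>
    obtain R where R: "finite R" "R \<noteq> {}" "\<Union>R = Z" "\<forall>K\<in>R. clique K E"
      "\<forall>K\<in>R. \<forall>L\<in>R. \<forall>u. u \<in> K \<longrightarrow> u \<in> L \<longrightarrow> K = L"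
      "\<forall>a\<ge>2. (\<forall>S\<subseteq>Z. indep S E \<longrightarrow> card S \<le> a) \<longrightarrow>
        a * card R + card Z \<le> a * card Z + a"
      using clique_partition[OF \<open>finite Z\<close>, of E] by (elim exE conjE) (rule that)
    define new where "new = insert x ` P \<union> insert y ` Q \<union> (\<lambda>K. insert x (insert y K)) ` R"
    define C where "C = C' \<union> new"
    have selfN: "v \<notin> ?N v" for v
      using neighborhood_subset[OF G, of v] by auto
    have NV: "?N v \<subseteq> V" for v
      using neighborhood_subset[OF G, of v] by auto
    have XYZ: "X \<subseteq> V'" "Y \<subseteq> V'" "Z \<subseteq> V'"
      using NV selfN by (auto simp: X_def Y_def Z_def V'_def)
    have XYZ_disj: "X \<inter> Y = {}" "X \<inter> Z = {}" "Y \<inter> Z = {}"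
      by (auto simp: X_def Y_def Z_def)
    have Nx: "?N x = insert y (X \<union> Z)" and Ny: "?N y = insert x (Y \<union> Z)"
      using xy by (auto simp: X_def Y_def Z_def mem_neighborhood insert_commute)
    have C'V: "K \<subseteq> V'" "clique K E'" if "K \<in> C'" for K
      using C' that by (auto simp: clique_covering_def)
    have covering: "clique_covering V E C"
      unfolding clique_covering_def
    proof (intro conjI ballI)
      fix K assume K: "K \<in> C"
      show "K \<subseteq> V"
        using K C'V(1) P(2) Q(2) R(3) XYZ xy(2,3) unfolding C_def new_def V'_def by blast
      consider "K \<in> C'" | L where "L \<in> P" "K = insert x L" | L where "L \<in> Q" "K = insert y L"
        | L where "L \<in> R" "K = insert x (insert y L)"
        using K by (auto simp: C_def new_def)
      then show "clique K E"
      proof cases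
        case 1
        then show ?thesis
          using C'V(2) by (auto simp: clique_def E'_def induced_edges_def)
      next
        case 2
        then show ?thesis
          using P(2,3) Nx by (auto intro!: clique_insert)
      next
        case 3
        then show ?thesis
          using Q(2,3) Ny by (auto intro!: clique_insert)
      next
        case 4
        then show ?thesis
          using R(3,4) Nx Ny by (auto intro!: clique_insert)
      qed
    next
      fix e assume e: "e \<in> E"
      \<comment> \<open>The edge xy is covered by means of any part \<open>M\<close> of
        \<open>R\<close>, possibly the empty one.\<close>
      have star_x: "\<exists>K\<in>C. {x, w} \<subseteq> K" if w: "{x, w} \<in> E" for w
      proof -
        obtain M where M: "M \<in> R"
          using R(2) by blast
        consider "w = y" | L where "L \<in> P" "w \<in> L" | L where "L \<in> R" "w \<in> L"
        proof -
          have "w \<in> insert y (X \<union> Z)"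
            using w unfolding Nx[symmetric] mem_neighborhood .
          then show thesis
            unfolding P(2)[symmetric] R(3)[symmetric] using that by blast
        qed
        then show ?thesis
        proof cases
          case 1
          have "insert x (insert y M) \<in> C"
            using M by (simp add: C_def new_def)
          then show ?thesis
            by (rule bexI[rotated]) (use 1 in simp)
        next
          case (2 L)
          then have "insert x L \<in> C"
            by (simp add: C_def new_def)
          then show ?thesis
            by (rule bexI[rotated]) (use 2 in simp)
        next
          case (3 L)
          then have "insert x (insert y L) \<in> C"
            by (simp add: C_def new_def)
          then show ?thesis
            by (rule bexI[rotated]) (use 3 in simp)
        qed
      qed
      have star_y: "\<exists>K\<in>C. {y, w} \<subseteq> K" if w: "{y, w} \<in> E" for w
      proof -
        obtain M where M: "M \<in> R"
          using R(2) by blast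
        consider "w = x" | L where "L \<in> Q" "w \<in> L" | L where "L \<in> R" "w \<in> L"
        proof -
          have "w \<in> insert x (Y \<union> Z)"
            using w unfolding Ny[symmetric] mem_neighborhood .
          then show thesis
            unfolding Q(2)[symmetric] R(3)[symmetric] using that by blast
        qed
        then show ?thesis
        proof cases
          case 1
          have "insert x (insert y M) \<in> C"
            using M by (simp add: C_def new_def)
          then show ?thesis
            by (rule bexI[rotated]) (use 1 in simp)
        next
          case (2 L)
          then have "insert y L \<in> C"
            by (simp add: C_def new_def)
          then show ?thesis
            by (rule bexI[rotated]) (use 2 in simp)
        next
          case (3 L)
          then have "insert x (insert y L) \<in> C"
            by (simp add: C_def new_def)
          then show ?thesis
            by (rule bexI[rotated]) (use 3 in simp)
        qed
      qed
      obtain v w where vw: "e = {v, w}" "v \<in> V" "w \<in> V" "v \<noteq> w"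
        using simple_graph_edgeE[OF G e] by blast
      show "\<exists>K\<in>C. e \<subseteq> K"
      proof (cases "e \<subseteq> V'")
        case True
        then have "e \<in> E'"
          using e by (simp add: E'_def induced_edges_def)
        then obtain K where "K \<in> C'" "e \<subseteq> K"
          using C' unfolding clique_covering_def by metis
        then show ?thesis
          unfolding C_def by (metis UnI1)
      next
        case False
        then have "v = x \<or> w = x \<or> v = y \<or> w = y"
          using vw by (auto simp: V'_def)
        moreover have "{w, v} \<in> E" "{v, w} \<in> E"
          using e vw(1) by (simp_all add: insert_commute)
        ultimately have "(\<exists>K\<in>C. {v, w} \<subseteq> K) \<or> (\<exists>K\<in>C. {w, v} \<subseteq> K)"
          using star_x star_y by auto
        then show ?thesis
          using vw(1) by blast
      qed
    qed
    have fin_new: "finite new"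
      using P(1) Q(1) R(1) by (simp add: new_def)
    \<comment> \<open>Old cliques lie in \<open>V'\<close> and the parts of \<open>Q\<close> in
      \<open>Y\<close>, so only the cliques built from \<open>R\<close> and \<open>P\<close> can
      contain x.\<close>
    have val_x: "valency C x \<le> card R + card P"
    proof -
      have "{K \<in> C. x \<in> K} \<subseteq> (\<lambda>K. insert x (insert y K)) ` R \<union> insert x ` P"
      proof
        fix K assume K: "K \<in> {K \<in> C. x \<in> K}"
        have "x \<notin> V'"
          by (simp add: V'_def)
        then have "K \<notin> C'" "K \<notin> insert y ` Q"
          using K C'V(1) Q(2) XYZ xy(4) by blast+
        then show "K \<in> (\<lambda>K. insert x (insert y K)) ` R \<union> insert x ` P"
          using K by (auto simp: C_def new_def)
      qed
      then have "valency C x \<le> card ((\<lambda>K. insert x (insert y K)) ` R \<union> insert x ` P)"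
        unfolding valency_def using P(1) R(1) by (intro card_mono) auto
      also have "\<dots> \<le> card R + card P"
        using P(1) R(1) by (meson add_mono card_Un_le card_image_le order_trans)
      finally show ?thesis .
    qed
    have val_y: "valency C y \<le> card R + card Q"
    proof -
      have "{K \<in> C. y \<in> K} \<subseteq> (\<lambda>K. insert x (insert y K)) ` R \<union> insert y ` Q"
      proof
        fix K assume K: "K \<in> {K \<in> C. y \<in> K}"
        have "y \<notin> V'"
          by (simp add: V'_def)
        then have "K \<notin> C'" "K \<notin> insert x ` P"
          using K C'V(1) P(2) XYZ xy(4) by blast+
        then show "K \<in> (\<lambda>K. insert x (insert y K)) ` R \<union> insert y ` Q"
          using K by (auto simp: C_def new_def)
      qed
      then have "valency C y \<le> card ((\<lambda>K. insert x (insert y K)) ` R \<union> insert y ` Q)"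
        unfolding valency_def using Q(1) R(1) by (intro card_mono) auto
      also have "\<dots> \<le> card R + card Q"
        using Q(1) R(1) by (meson add_mono card_Un_le card_image_le order_trans)
      finally show ?thesis .
    qed
    have val_other: "valency C v \<le> valency C' v + 1" if v: "v \<in> V'" for v
    proof -
      \<comment> \<open>Disjointness of \<open>X\<close>, \<open>Y\<close>, \<open>Z\<close>
        determines which of the three families a new clique through v belongs to; disjointness of
        the parts then determines the clique.\<close>
      have uniq: "K = L" if "K \<in> new" "L \<in> new" "v \<in> K" "v \<in> L" for K L
      proof -
        have v_ne: "v \<noteq> x" "v \<noteq> y"
          using v by (auto simp: V'_def)
        have shape: "(\<exists>M\<in>P. v \<in> M \<and> v \<in> X \<and> T = insert x M) \<or>
            (\<exists>M\<in>Q. v \<in> M \<and> v \<in> Y \<and> T = insert y M) \<or>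
            (\<exists>M\<in>R. v \<in> M \<and> v \<in> Z \<and> T = insert x (insert y M))"
          if "T \<in> new" "v \<in> T" for T
          using that v_ne P(2) Q(2) R(3) unfolding new_def by blast
        note K = shape[OF that(1,3)] and L = shape[OF that(2,4)]
        consider "v \<in> X" "v \<notin> Y" "v \<notin> Z" | "v \<in> Y" "v \<notin> X" "v \<notin> Z"
          | "v \<in> Z" "v \<notin> X" "v \<notin> Y"
        proof -
          have "v \<in> X \<or> v \<in> Y \<or> v \<in> Z"
            using K by (elim disjE bexE conjE) simp_all
          moreover have "\<not> (v \<in> X \<and> v \<in> Y)" "\<not> (v \<in> X \<and> v \<in> Z)" "\<not> (v \<in> Y \<and> v \<in> Z)"
            using XYZ_disj by (simp_all add: disjoint_iff)
          ultimately show thesis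
            using that by argo
        qed
        then show ?thesis
        proof cases
          case 1
          have "\<exists>M\<in>P. v \<in> M \<and> K = insert x M" "\<exists>M\<in>P. v \<in> M \<and> L = insert x M"
            using K L 1 by simp_all
          then obtain M M' where M: "M \<in> P" "v \<in> M" "K = insert x M"
            "M' \<in> P" "v \<in> M'" "L = insert x M'"
            by (elim bexE conjE) (rule that)
          then have "M = M'"
            using P(4) by metis
          then show ?thesis
            using M by simp
        next
          case 2
          have "\<exists>M\<in>Q. v \<in> M \<and> K = insert y M" "\<exists>M\<in>Q. v \<in> M \<and> L = insert y M"
            using K L 2 by simp_all
          then obtain M M' where M: "M \<in> Q" "v \<in> M" "K = insert y M"
            "M' \<in> Q" "v \<in> M'" "L = insert y M'"
            by (elim bexE conjE) (rule that)
          then have "M = M'"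
            using Q(4) by metis
          then show ?thesis
            using M by simp
        next
          case 3
          have "\<exists>M\<in>R. v \<in> M \<and> K = insert x (insert y M)" "\<exists>M\<in>R. v \<in> M \<and> L = insert x (insert y M)"
            using K L 3 by simp_all
          then obtain M M' where M: "M \<in> R" "v \<in> M" "K = insert x (insert y M)"
            "M' \<in> R" "v \<in> M'" "L = insert x (insert y M')"
            by (elim bexE conjE) (rule that)
          then have "M = M'"
            using R(5) by metis
          then show ?thesis
            using M by simp
        qed
      qed
      have "{K \<in> C. v \<in> K} = {K \<in> C'. v \<in> K} \<union> {K \<in> new. v \<in> K}"
        by (auto simp: C_def)
      then have "valency C v \<le> valency C' v + card {K \<in> new. v \<in> K}"
        unfolding valency_def by (metis card_Un_le)
      moreover have "card {K \<in> new. v \<in> K} \<le> 1"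
        using fin_new uniq by (subst One_nat_def, subst card_le_Suc0_iff_eq) auto
      ultimately show ?thesis
        by linarith
    qed
    \<comment> \<open>The 2 counts y, which lies in N(x) outside both \<open>X\<close> and
      \<open>Z\<close>, and x itself.\<close>
    have deg_x: "card X + card Z + 2 \<le> card V"
    proof -
      have "card (?N x) = Suc (card X + card Z)"
        unfolding Nx using XYZ XYZ_disj \<open>finite X\<close> \<open>finite Z\<close>
        by (subst card_insert_disjoint) (auto simp: V'_def card_Un_disjoint)
      then show ?thesis
        using card_neighborhood_less[OF G xy(2)] by linarith
    qed
    have deg_y: "card Y + card Z + 2 \<le> card V"
    proof -
      have "card (?N y) = Suc (card Y + card Z)"
        unfolding Ny using XYZ XYZ_disj \<open>finite Y\<close> \<open>finite Z\<close>
        by (subst card_insert_disjoint) (auto simp: V'_def card_Un_disjoint)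
      then show ?thesis
        using card_neighborhood_less[OF G xy(3)] by linarith
    qed
    \<comment> \<open>Before merging, the bound is available only for a \<ge> 2; simplicial vertices
      are left to \<open>D\<close>.\<close>
    have bound: "a * valency C v + card V \<le> a * card V + a"
      if v: "v \<in> V" and a: "a \<ge> 2" and S: "\<forall>S\<subseteq>?N v. indep S E \<longrightarrow> card S \<le> a" for v a
    proof -
      consider "v = x" | "v = y" | "v \<in> V'"
        using v by (auto simp: V'_def)
      then show ?thesis
      proof cases
        case 1
        have "Z \<subseteq> ?N v" "X \<subseteq> ?N v"
          using 1 Nx by auto
        then have "\<forall>S\<subseteq>Z. indep S E \<longrightarrow> card S \<le> a" "\<forall>S\<subseteq>X. indep S E \<longrightarrow> card S \<le> a"
          using S by (meson subset_trans)+
        then have "a * card R + card Z \<le> a * card Z + a" "a * card P + card X \<le> a * card X + a"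
          using a R(6) P(5) by simp_all
        then show ?thesis
          using valency_bound_edge_end[OF a _ _ deg_x, of "card R" "card P"] val_x 1 by auto
      next
        case 2
        have "Z \<subseteq> ?N v" "Y \<subseteq> ?N v"
          using 2 Ny by auto
        then have "\<forall>S\<subseteq>Z. indep S E \<longrightarrow> card S \<le> a" "\<forall>S\<subseteq>Y. indep S E \<longrightarrow> card S \<le> a"
          using S by (meson subset_trans)+
        then have "a * card R + card Z \<le> a * card Z + a" "a * card Q + card Y \<le> a * card Y + a"
          using a R(6) Q(5) by simp_all
        then show ?thesis
          using valency_bound_edge_end[OF a _ _ deg_y, of "card R" "card Q"] val_y 2 by auto
      next
        case 3
        have "a * valency C' v + card V' \<le> a * card V' + a"
        proof (cases "isolated E' v")
          case True
          then show ?thesis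
            using iso' a by (simp add: trans_le_add1)
        next
          case False
          \<comment> \<open>Since \<open>E'\<close> is induced, independent subsets of
            \<open>V'\<close> are the same for \<open>E'\<close> and \<open>E\<close>, so a remains
            admissible in the smaller graph.\<close>
          have "card S \<le> a" if "S \<subseteq> neighborhood E' v" "indep S E'" for S
          proof -
            have "S \<subseteq> V'"
              using that(1) neighborhood_subset[OF G', of v] by auto
            then have "indep S E"
              using that(2) by (auto simp: indep_def E'_def induced_edges_def)
            moreover have "S \<subseteq> ?N v"
              using that(1) by (auto simp: neighborhood_def E'_def induced_edges_def)
            ultimately show ?thesis
              using S by blast
          qed
          then show ?thesis
            using bound' 3 False by blast
        qed
        \<comment> \<open>One more clique and two more vertices add at most a + 2 on the left and 2a
          on the right.\<close>
        moreover have "a * valency C v \<le> a * valency C' v + a"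
          using mult_le_mono2[OF val_other[OF 3], of a] by simp
        ultimately show ?thesis
          using a by (simp add: cardV algebra_simps)
      qed
    qed
    obtain D where D: "clique_covering V E D" "\<forall>v. valency D v \<le> valency C v"
      "\<forall>v. isolated E v \<longrightarrow> valency D v = 0" "\<forall>v. simplicial E v \<longrightarrow> valency D v \<le> 1"
      using clique_covering_merge_simplicial[OF G covering] by blast
    have "a * valency D v + card V \<le> a * card V + a"
      if v: "v \<in> V" "\<not> isolated E v" and S: "\<forall>S\<subseteq>?N v. indep S E \<longrightarrow> card S \<le> a" for v a
    proof (cases "simplicial E v")
      \<comment> \<open>Any single neighbor gives a \<ge> 1, and then valency at most 1 is
        enough.\<close>
      case True
      obtain w where "w \<in> ?N v"
        using v by (auto simp: isolated_def)
      then have "card {w} \<le> a"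
        using S by (auto simp: indep_def)
      then have "card V \<le> a * card V" by simp
      moreover have "a * valency D v \<le> a * 1"
        using D(4) True by (intro mult_le_mono2) auto
      ultimately show ?thesis
        by linarith
    next
      case False
      \<comment> \<open>Two non-adjacent neighbors force a \<ge> 2, so the bound for
        \<open>C\<close> applies and passes to \<open>D\<close>.\<close>
      then obtain u w where uw: "u \<in> ?N v" "w \<in> ?N v" "u \<noteq> w" "{u, w} \<notin> E"
        using v by (auto simp: simplicial_def clique_def)
      then have "indep {u, w} E"
        by (auto simp: indep_def insert_commute)
      moreover have "{u, w} \<subseteq> ?N v"
        using uw by simp
      ultimately have "card {u, w} \<le> a"
        using S by blast
      then have "a \<ge> 2"
        using uw by simp
      then have "a * valency C v + card V \<le> a * card V + a"
        using bound[OF v(1) _ S] by blast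
      moreover have "a * valency D v \<le> a * valency C v"
        using D(2) by simp
      ultimately show ?thesis
        by linarith
    qed
    then show ?thesis
      using D by blast
  qed
qed

section \<open>Specialization to the local independence number\<close>

text \<open>This makes \<alpha>(v) an admissible value of a: independence for \<open>E\<close>
  carries over to the induced edges, and the maximum is over a finite set.\<close>

lemma card_le_local_independence_number:
  assumes "simple_graph V E" "S \<subseteq> neighborhood E v" "indep S E"
  shows "card S \<le> local_independence_number E v"
  unfolding local_independence_number_def independence_number_def
  using assms finite_neighborhood[OF assms(1), of v]
  by (intro Max_ge) (auto simp: indep_def induced_edges_def)

theorem theorem7:
  fixes V :: "'a set" and E :: "'a set set" and n :: nat
  assumes "simple_graph V E"
    and "card V = n"
  shows "\<exists>\<C>. clique_covering V E \<C> \<and>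
    (\<forall>v\<in>V. \<not> isolated E v \<longrightarrow>
      real (valency \<C> v) + real n / real (local_independence_number E v) \<le> real n + 1)"
proof -
  obtain C where C: "clique_covering V E C" and
    bound: "\<And>v a. v \<in> V \<Longrightarrow> \<not> isolated E v \<Longrightarrow>
      (\<forall>S\<subseteq>neighborhood E v. indep S E \<longrightarrow> card S \<le> a) \<Longrightarrow>
      a * valency C v + card V \<le> a * card V + a"
    using exists_clique_covering[OF assms(1)] by blast
  have "real (valency C v) + real n / real (local_independence_number E v) \<le> real n + 1"
    if v: "v \<in> V" "\<not> isolated E v" for v
  proof -
    let ?a = "local_independence_number E v"
    have "?a * valency C v + n \<le> ?a * n + ?a"
      using bound[OF v, of ?a] card_le_local_independence_number[OF assms(1)] assms(2) by blast
    then have "real (?a * valency C v + n) \<le> real (?a * n + ?a)"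
      using of_nat_le_iff by blast
    \<comment> \<open>Division by \<alpha>(v) \<ge> 1 turns the multiplied bound into the stated
      one.\<close>
    then show ?thesis
      using local_independence_number_ge_1[OF assms(1) v(2)] by (simp add: field_simps)
  qed
  then show ?thesis
    using C by blast
qed

end
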